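(* For Cantor space $X=2^{\mathbb N}$, $$\mathsf{BCT}_2\not\le_{\mathrm W}1\text{-}\mathsf{GEN}.$$
   Context: Represented spaces and Weihrauch reducibility. The symbol $\subseteq$ in front of a domain means "possibly partial". A represented space $(X,\delta_X)$ is a set $X$ with a surjective partial map $\delta_X:\subseteq\mathbb N^{\mathbb N}\to X$. A multi-valued function $f:\subseteq X\rightrightarrows Y$ assigns to each $x\in\mathrm{dom}(f)$ a nonempty set $f(x)\subseteq Y$. A realizer $F\vdash f$ is a partial function $F:\subseteq\mathbb N^{\mathbb N}\to\mathbb N^{\mathbb N}$ with $\delta_YF(p)\in f(\delta_X(p))$ for all $p\in\mathrm{dom}(f\delta_X)$. $f\le_{\mathrm W}g$: there are computable $K,H:\subseteq\mathbb N^{\mathbb N}\to\mathbb N^{\mathbb N}$ with $H\langle\mathrm{id},GK\rangle\vdash f$ for all $G\vdash g$, where $\langle p,q\rangle(2k)=p(k)$, $\langle p,q\rangle(2k+1)=q(k)$. With $\langle p_0,p_1,\dots\rangle(\langle i,j\rangle):=p_i(j)$, $X^{\mathbb N}$ is represented by $\delta_X^{\mathbb N}\langle p_0,p_1,\dots\rangle:=(\delta_X(p_i))_i$. Points of $2^{\mathbb N}$ name themselves. $\mathcal A_+(2^{\mathbb N})$ is the set of closed subsets $A$ of $2^{\mathbb N}$, a name of $A$ being a name of a sequence $(x_n)_n$ in $2^{\mathbb N}\sqcup\{\infty\}$ with $\overline{\{x_n:n\in\mathbb N\}}\cap2^{\mathbb N}=A$, where $\infty$ is an added isolated point. $\mathsf{BCT}_2:\subseteq\mathcal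 A_+(2^{\mathbb N})^{\mathbb N}\rightrightarrows2^{\mathbb N}$ maps $(A_i)_i$ to $2^{\mathbb N}\setminus\bigcup_iA_i$, with domain all $(A_i)_i$ such that every $A_i$ has empty interior. For $q\in2^{\mathbb N}$ let $U_i^q:=\{p\in2^{\mathbb N}:\varphi_i^{\langle p,q\rangle}(0)\downarrow\}$, where $\varphi_i^r$ is the $i$-th partial function computable with oracle $r$. A point $p\in2^{\mathbb N}$ is 1-generic in $q$ if for all $i$ there is a finite prefix $w$ of $p$ with $w2^{\mathbb N}\subseteq U_i^q$ or $w2^{\mathbb N}\cap U_i^q=\emptyset$. $1\text{-}\mathsf{GEN}:2^{\mathbb N}\rightrightarrows2^{\mathbb N}$ is $1\text{-}\mathsf{GEN}(q):=\{p:p\text{ is 1-generic in }q\}$. *)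

theory Defs
  imports "HOL-Analysis.Analysis" "HOL-Library.Nat_Bijection"
begin

section \<open>Functions computable with an oracle\<close>

text \<open>
  Partial recursive functions relative to an oracle, as unary functions on \<open>nat\<close> with the Cantor
  pairing \<^const>\<open>prod_encode\<close> for tuples.
\<close>

datatype prog =
  Zero | Succ | Proj1 | Proj2 | Query
  | Pairing prog prog | Comp prog prog | PrimRec prog prog | Minimize prog

primrec run :: "prog \<Rightarrow> (nat \<Rightarrow> nat) \<Rightarrow> nat \<Rightarrow> nat option" where
  "run Zero r x = Some 0"
| "run Succ r x = Some (Suc x)"
| "run Proj1 r x = Some (fst (prod_decode x))"
| "run Proj2 r x = Some (snd (prod_decode x))"
| "run Query r x = Some (r x)"
| "run (Pairing f g) r x =
     Option.bind (run f r x) (\<lambda>a. Option.bind (run g r x) (\<lambda>b. Some (prod_encode (a, b))))"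
| "run (Comp f g) r x = Option.bind (run g r x) (run f r)"
| "run (PrimRec f g) r x =
     rec_nat (run f r (fst (prod_decode x)))
       (\<lambda>k v. Option.bind v
          (\<lambda>b. run g r (prod_encode (fst (prod_decode x), prod_encode (k, b)))))
       (snd (prod_decode x))"
| "run (Minimize f) r x =
     (let P = (\<lambda>n. run f r (prod_encode (x, n)) = Some 0 \<and>
                   (\<forall>m<n. run f r (prod_encode (x, m)) \<noteq> None))
      in if \<exists>n. P n then Some (LEAST n. P n) else None)"

function prog_of_nat :: "nat \<Rightarrow> prog" where
  "prog_of_nat n =
    (if n = 0 then Zero else if n = 1 then Succ else if n = 2 then Proj1
     else if n = 3 then Proj2 else if n = 4 then Query
     else let m = (n - 5) div 4; a = fst (prod_decode m); b = snd (prod_decode m) in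
       if (n - 5) mod 4 = 0 then Pairing (prog_of_nat a) (prog_of_nat b)
       else if (n - 5) mod 4 = 1 then Comp (prog_of_nat a) (prog_of_nat b)
       else if (n - 5) mod 4 = 2 then PrimRec (prog_of_nat a) (prog_of_nat b)
       else Minimize (prog_of_nat m))"
  by pat_completeness auto
termination
proof (relation "Wellfounded.measure id", goal_cases)
  case 1
  then show ?case by simp
next
  have L: "fst (prod_decode m) \<le> m" and R: "snd (prod_decode m) \<le> m" for m
    using le_prod_encode_1[of "fst (prod_decode m)" "snd (prod_decode m)"]
      le_prod_encode_2[of "snd (prod_decode m)" "fst (prod_decode m)"]
    by simp_all
  have D: "(n - 5) div 4 < n" if "n \<noteq> 0" for n :: nat
    using that by linarith
  {
    case 2 then show ?case using L D by (auto intro: le_less_trans)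
  next
    case 3 then show ?case using R D by (auto intro: le_less_trans)
  next
    case 4 then show ?case using L D by (auto intro: le_less_trans)
  next
    case 5 then show ?case using R D by (auto intro: le_less_trans)
  next
    case 6 then show ?case using L D by (auto intro: le_less_trans)
  next
    case 7 then show ?case using R D by (auto intro: le_less_trans)
  next
    case 8 then show ?case using D by auto
  }
qed

declare prog_of_nat.simps [simp del]

lemma surj_prog_of_nat: "surj prog_of_nat"
proof -
  have "\<exists>n. prog_of_nat n = c" for c
  proof (induction c)
    case Zero
    show ?case by (rule exI[of _ 0]) (simp add: prog_of_nat.simps)
  next
    case Succ
    show ?case by (rule exI[of _ 1]) (simp add: prog_of_nat.simps)
  next
    case Proj1
    show ?case by (rule exI[of _ 2]) (simp add: prog_of_nat.simps)
  next
    case Proj2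
    show ?case by (rule exI[of _ 3]) (simp add: prog_of_nat.simps)
  next
    case Query
    show ?case by (rule exI[of _ 4]) (simp add: prog_of_nat.simps)
  next
    case (Pairing f g)
    then obtain a b where "prog_of_nat a = f" "prog_of_nat b = g" by blast
    then show ?case
      by (intro exI[of _ "5 + 4 * prod_encode (a, b)"])
        (subst prog_of_nat.simps, simp add: Let_def)
  next
    case (Comp f g)
    then obtain a b where ab: "prog_of_nat a = f" "prog_of_nat b = g" by blast
    have "(4 * prod_encode (a, b) + 1) div 4 = prod_encode (a, b)"
      "(4 * prod_encode (a, b) + 1) mod 4 = 1" by presburger+
    with ab show ?case
      by (intro exI[of _ "5 + (4 * prod_encode (a, b) + 1)"])
        (subst prog_of_nat.simps, simp add: Let_def)
  next
    case (PrimRec f g)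
    then obtain a b where ab: "prog_of_nat a = f" "prog_of_nat b = g" by blast
    have "(4 * prod_encode (a, b) + 2) div 4 = prod_encode (a, b)"
      "(4 * prod_encode (a, b) + 2) mod 4 = 2" by presburger+
    with ab show ?case
      by (intro exI[of _ "5 + (4 * prod_encode (a, b) + 2)"])
        (subst prog_of_nat.simps, simp add: Let_def)
  next
    case (Minimize f)
    then obtain a where a: "prog_of_nat a = f" by blast
    have "(4 * a + 3) div 4 = a" "(4 * a + 3) mod 4 = 3" by presburger+
    with a show ?case
      by (intro exI[of _ "5 + (4 * a + 3)"])
        (subst prog_of_nat.simps, simp add: Let_def)
  qed
  then show ?thesis by (metis surjI)
qed

definition phi :: "nat \<Rightarrow> (nat \<Rightarrow> nat) \<Rightarrow> nat \<Rightarrow> nat option" where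
  "phi i r = run (prog_of_nat i) r"

text \<open>
  A partial function on Baire space is computable if some oracle program computes it on its domain;
  nothing is required of the program on other inputs.
\<close>

definition computable_baire :: "((nat \<Rightarrow> nat) \<rightharpoonup> (nat \<Rightarrow> nat)) \<Rightarrow> bool" where
  "computable_baire F \<longleftrightarrow>
     (\<exists>i. \<forall>p\<in>dom F. \<forall>n. phi i p n = Some (the (F p) n))"


section \<open>Represented spaces and Weihrauch reducibility\<close>

text \<open>
  A representation is a partial map; the represented space is its range, so that it is
  surjective by construction.  A multi-valued function takes the value \<open>{}\<close> exactly outside its
  domain.
\<close>

type_synonym 'a repr = "(nat \<Rightarrow> nat) \<rightharpoonup> 'a"
type_synonym ('a, 'b) multifun = "'a \<Rightarrow> 'b set"

definition mdom :: "('a, 'b) multifun \<Rightarrow> 'a set" where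
  "mdom f = {x. f x \<noteq> {}}"

definition realizes ::
  "'a repr \<Rightarrow> 'b repr \<Rightarrow> ((nat \<Rightarrow> nat) \<rightharpoonup> (nat \<Rightarrow> nat)) \<Rightarrow> ('a, 'b) multifun \<Rightarrow> bool" where
  "realizes \<delta>X \<delta>Y F f \<longleftrightarrow>
     (\<forall>p x. \<delta>X p = Some x \<longrightarrow> x \<in> mdom f \<longrightarrow>
        (\<exists>r y. F p = Some r \<and> \<delta>Y r = Some y \<and> y \<in> f x))"

definition join :: "(nat \<Rightarrow> nat) \<Rightarrow> (nat \<Rightarrow> nat) \<Rightarrow> nat \<Rightarrow> nat" where
  "join p q n = (if even n then p (n div 2) else q (n div 2))"

definition weihrauch_le ::
  "'a repr \<Rightarrow> 'b repr \<Rightarrow> ('a, 'b) multifun \<Rightarrow> 'c repr \<Rightarrow> 'd repr \<Rightarrow> ('c, 'd) multifun \<Rightarrow> bool" where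
  "weihrauch_le \<delta>X \<delta>Y f \<delta>Z \<delta>W g \<longleftrightarrow>
     (\<exists>K H. computable_baire K \<and> computable_baire H \<and>
        (\<forall>G. realizes \<delta>Z \<delta>W G g \<longrightarrow>
           realizes \<delta>X \<delta>Y
             (\<lambda>p. Option.bind (K p) (\<lambda>k. Option.bind (G k) (\<lambda>r. H (join p r)))) f))"

definition column :: "(nat \<Rightarrow> nat) \<Rightarrow> nat \<Rightarrow> nat \<Rightarrow> nat" where
  "column p i j = p (prod_encode (i, j))"

definition repr_seq :: "'a repr \<Rightarrow> (nat \<Rightarrow> 'a) repr" where
  "repr_seq \<delta> p =
     (if \<forall>i. column p i \<in> dom \<delta> then Some (\<lambda>i. the (\<delta> (column p i))) else None)"


section \<open>Cantor space and its closed subsets\<close>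

text \<open>The topology on this type is the product of the discrete topologies.\<close>

type_synonym cantor = "nat \<Rightarrow> bool"

definition name_of :: "cantor \<Rightarrow> nat \<Rightarrow> nat" where
  "name_of x n = of_bool (x n)"

definition repr_cantor :: "cantor repr" where
  "repr_cantor p = (if range p \<subseteq> {0, 1} then Some (\<lambda>n. p n = 1) else None)"

lemma repr_cantor_eq_Some_iff: "repr_cantor p = Some x \<longleftrightarrow> p = name_of x"
proof
  assume "repr_cantor p = Some x"
  then have "range p \<subseteq> {0, 1}" "x = (\<lambda>n. p n = 1)"
    by (auto simp: repr_cantor_def split: if_splits)
  then show "p = name_of x" by (auto simp: name_of_def fun_eq_iff of_bool_def)
qed (auto simp: repr_cantor_def name_of_def)

datatype cantor_inf = Point cantor | Infinity

instantiation cantor_inf :: topological_space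
begin

text \<open>The coproduct topology: \<^const>\<open>Infinity\<close> is isolated.\<close>

definition open_cantor_inf :: "cantor_inf set \<Rightarrow> bool" where
  "open_cantor_inf U \<longleftrightarrow> open (Point -` U)"

instance
  by standard (auto simp: open_cantor_inf_def vimage_Union)

end

text \<open>
  The coproduct representation: the first entry of a name tells which summand is meant, and the
  rest of the name is ignored for \<^const>\<open>Infinity\<close>.
\<close>

definition repr_cantor_inf :: "cantor_inf repr" where
  "repr_cantor_inf p =
     (if p 0 = 0 then map_option Point (repr_cantor (\<lambda>n. p (Suc n)))
      else if p 0 = 1 then Some Infinity else None)"

definition repr_closed_pos :: "cantor set repr" where
  "repr_closed_pos p =
     map_option (\<lambda>x. Point -` closure (range x)) (repr_seq repr_cantor_inf p)"

definition BCT2 :: "(nat \<Rightarrow> cantor set, cantor) multifun" where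
  "BCT2 A = (if \<forall>i. closed (A i) \<and> interior (A i) = {} then UNIV - (\<Union>i. A i) else {})"


section \<open>One-generic points\<close>

definition cylinder :: "bool list \<Rightarrow> cantor set" where
  "cylinder w = {p. \<forall>k<length w. p k = w ! k}"

definition U_set :: "nat \<Rightarrow> cantor \<Rightarrow> cantor set" where
  "U_set i q = {p. phi i (join (name_of p) (name_of q)) 0 \<noteq> None}"

definition one_generic_in :: "cantor \<Rightarrow> cantor \<Rightarrow> bool" where
  "one_generic_in p q \<longleftrightarrow>
     (\<forall>i. \<exists>w. p \<in> cylinder w \<and> (cylinder w \<subseteq> U_set i q \<or> cylinder w \<inter> U_set i q = {}))"

definition one_GEN :: "(cantor, cantor) multifun" where
  "one_GEN q = {p. one_generic_in p q}"


section \<open>Ranges of the representations and domains of the problems\<close>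

lemma ran_repr_cantor: "ran repr_cantor = UNIV"
  by (auto simp: ran_def repr_cantor_eq_Some_iff)

lemma column_surj:
  fixes s :: "nat \<Rightarrow> nat \<Rightarrow> nat"
  shows "\<exists>p. \<forall>i. column p i = s i"
  by (rule exI[of _ "\<lambda>n. s (fst (prod_decode n)) (snd (prod_decode n))"])
    (simp add: column_def fun_eq_iff)

lemma ran_repr_seq: "ran (repr_seq \<delta>) = {x :: nat \<Rightarrow> 'a. \<forall>i. x i \<in> ran \<delta>}"
proof (intro equalityI subsetI)
  fix x assume "x \<in> ran (repr_seq \<delta>)"
  then obtain p where "\<And>i. column p i \<in> dom \<delta>" "x = (\<lambda>i. the (\<delta> (column p i)))"
    by (auto simp: ran_def repr_seq_def split: if_splits)
  then have "\<delta> (column p i) = Some (x i)" for i by (simp add: domIff)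
  then show "x \<in> {x. \<forall>i. x i \<in> ran \<delta>}" by (auto intro: ranI)
next
  fix x :: "nat \<Rightarrow> 'a" assume "x \<in> {x. \<forall>i. x i \<in> ran \<delta>}"
  then have "\<forall>i. \<exists>p. \<delta> p = Some (x i)" by (auto simp: ran_def)
  then obtain s where s: "\<And>i. \<delta> (s i) = Some (x i)" by metis
  obtain p where "\<forall>i. column p i = s i" using column_surj by blast
  with s have "repr_seq \<delta> p = Some x" by (auto simp: repr_seq_def)
  then show "x \<in> ran (repr_seq \<delta>)" by (auto simp: ran_def)
qed

lemma ran_repr_cantor_inf: "ran repr_cantor_inf = UNIV"
proof -
  have "\<exists>p. repr_cantor_inf p = Some z" for z
  proof (cases z)
    case (Point x)
    then show ?thesis
      by (intro exI[of _ "case_nat 0 (name_of x)"])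
        (simp add: repr_cantor_inf_def repr_cantor_eq_Some_iff)
  next
    case Infinity
    then show ?thesis by (intro exI[of _ "\<lambda>_. 1"]) (simp add: repr_cantor_inf_def)
  qed
  then show ?thesis by (auto simp: ran_def)
qed

lemma Point_vimage_closure: "Point -` closure S = closure (Point -` S)"
proof (intro equalityI subsetI)
  fix x assume x: "x \<in> Point -` closure S"
  show "x \<in> closure (Point -` S)"
    unfolding closure_iff_nhds_not_empty
  proof (intro allI impI)
    fix A V assume V: "V \<subseteq> A" "open V" "x \<in> V"
    have "open (Point ` V)" using V by (simp add: open_cantor_inf_def inj_vimage_image_eq inj_def)
    then have "S \<inter> Point ` V \<noteq> {}"
      using x V closure_iff_nhds_not_empty[of "Point x" S] by blast
    then show "Point -` S \<inter> A \<noteq> {}" using V by blast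
  qed
next
  fix x assume x: "x \<in> closure (Point -` S)"
  show "x \<in> Point -` closure S"
    unfolding vimage_eq closure_iff_nhds_not_empty
  proof (intro allI impI)
    fix A V assume V: "V \<subseteq> A" "open V" "Point x \<in> V"
    then have "open (Point -` V)" by (simp add: open_cantor_inf_def)
    then have "Point -` S \<inter> Point -` V \<noteq> {}"
      using x V closure_iff_nhds_not_empty[of x "Point -` S"] by blast
    then show "S \<inter> A \<noteq> {}" using V by blast
  qed
qed

lemma cylinder_subset_open:
  assumes "open V" "p \<in> V"
  obtains w where "p \<in> cylinder w" "cylinder w \<subseteq> V"
proof -
  from assms have "openin (product_topology (\<lambda>_::nat. euclidean :: bool topology) UNIV) V"
    by (simp add: euclidean_product_topology)
  then obtain X where "p \<in> Pi\<^sub>E UNIV X" "finite {i. X i \<noteq> topspace (euclidean :: bool topology)}"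
      "Pi\<^sub>E UNIV X \<subseteq> V"
    using product_topology_open_contains_basis[OF _ assms(2)] by blast
  then have X: "finite {i. X i \<noteq> UNIV}" "p \<in> Pi\<^sub>E UNIV X" "Pi\<^sub>E UNIV X \<subseteq> V"
    by (simp_all only: topspace_euclidean)
  then obtain N where "{i. X i \<noteq> UNIV} \<subseteq> {..<N}"
    using finite_nat_iff_bounded by blast
  then have N: "X i = UNIV" if "\<not> i < N" for i using that by blast
  show thesis
  proof
    show "p \<in> cylinder (map p [0..<N])" by (simp add: cylinder_def)
    show "cylinder (map p [0..<N]) \<subseteq> V"
    proof
      fix x assume "x \<in> cylinder (map p [0..<N])"
      then have "\<forall>k<N. x k = p k" by (simp add: cylinder_def)
      then have "x i \<in> X i" for i
        using N[of i] PiE_mem[OF X(2), of i] by (cases "i < N") simp_all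
      then have "x \<in> Pi\<^sub>E UNIV X" by (simp add: PiE_UNIV_domain)
      then show "x \<in> V" using X(3) by blast
    qed
  qed
qed

lemma countable_dense_subset:
  fixes A :: "cantor set"
  obtains D where "countable D" "D \<subseteq> A" "A \<subseteq> closure D"
proof -
  have "\<forall>w. \<exists>x. cylinder w \<inter> A \<noteq> {} \<longrightarrow> x \<in> cylinder w \<inter> A" by blast
  then obtain d where d: "\<And>w. cylinder w \<inter> A \<noteq> {} \<Longrightarrow> d w \<in> cylinder w \<inter> A" by metis
  define D where "D = d ` {w. cylinder w \<inter> A \<noteq> {}}"
  show thesis
  proof
    show "countable D" by (simp add: D_def)
    show "D \<subseteq> A" using d by (force simp: D_def)
    show "A \<subseteq> closure D"
    proof
      fix x assume "x \<in> A"
      show "x \<in> closure D" unfolding closure_iff_nhds_not_empty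
      proof (intro allI impI)
        fix W V assume "V \<subseteq> W" "open V" "x \<in> V"
        then obtain w where w: "x \<in> cylinder w" "cylinder w \<subseteq> V"
          using cylinder_subset_open by metis
        then have "cylinder w \<inter> A \<noteq> {}" using \<open>x \<in> A\<close> by blast
        then have "d w \<in> D \<inter> cylinder w" using d unfolding D_def by blast
        then show "D \<inter> W \<noteq> {}" using w \<open>V \<subseteq> W\<close> by blast
      qed
    qed
  qed
qed

lemma ran_repr_closed_pos: "ran repr_closed_pos = {A. closed A}"
proof (intro equalityI subsetI)
  fix A assume "A \<in> ran repr_closed_pos"
  then obtain p where "repr_closed_pos p = Some A" by (auto simp: ran_def)
  then obtain x :: "nat \<Rightarrow> cantor_inf" where "Point -` closure (range x) = A"
    by (auto simp: repr_closed_pos_def)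
  then have "A = closure (Point -` range x)" by (simp only: Point_vimage_closure)
  then show "A \<in> {A. closed A}" by (simp only: closed_closure mem_Collect_eq)
next
  fix A :: "cantor set" assume "A \<in> {A. closed A}"
  then have A: "closed A" by simp
  obtain D where D: "countable D" "D \<subseteq> A" "A \<subseteq> closure D"
    using countable_dense_subset[of A] by blast
  have "closure D = A" using A D by (simp add: closure_minimal subset_antisym)
  moreover have "countable (insert Infinity (Point ` D))" using D by simp
  then obtain x :: "nat \<Rightarrow> cantor_inf" where x: "range x = insert Infinity (Point ` D)"
    by (metis insert_not_empty range_from_nat_into)
  moreover have "Point -` range x = D" by (auto simp: x)
  ultimately have "A = Point -` closure (range x)" by (simp only: Point_vimage_closure)
  moreover have "x \<in> ran (repr_seq repr_cantor_inf)"
    by (simp only: ran_repr_seq ran_repr_cantor_inf mem_Collect_eq UNIV_I simp_thms)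
  then obtain p where "repr_seq repr_cantor_inf p = Some x" unfolding ran_def by blast
  ultimately have "repr_closed_pos p = Some A" by (simp only: repr_closed_pos_def option.map)
  then show "A \<in> ran repr_closed_pos" unfolding ran_def by blast
qed

lemma cantor_Baire:
  fixes A :: "nat \<Rightarrow> cantor set"
  assumes "\<And>i. closed (A i)" "\<And>i. interior (A i) = {}"
  shows "\<Union>(range A) \<noteq> UNIV"
proof -
  have "compact (UNIV :: bool set)" by (simp add: finite_imp_compact)
  then have "compact_space (euclidean :: bool topology)" by (simp add: compact_space_def)
  then have "compact_space (product_topology (\<lambda>_::nat. euclidean :: bool topology) UNIV)"
    by (simp add: compact_space_product_topology)
  then have "compact_space (euclidean :: cantor topology)"
    by (simp add: euclidean_product_topology)
  moreover have "Hausdorff_space (euclidean :: bool topology)"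
    unfolding Hausdorff_space_def disjnt_def by (metis hausdorff open_openin)
  then have "Hausdorff_space (euclidean :: cantor topology)"
    using Hausdorff_space_product_topology[of "\<lambda>_::nat. euclidean :: bool topology" UNIV]
    unfolding euclidean_product_topology by blast
  ultimately have "locally_compact_space (euclidean :: cantor topology)"
    "regular_space (euclidean :: cantor topology)"
    by (simp_all only: compact_imp_locally_compact_space compact_Hausdorff_imp_regular_space)
  then have "euclidean interior_of \<Union>(range A) = {}"
    by (intro Baire_category_alt disjI2 conjI) (use assms in auto)
  then show ?thesis by auto
qed

lemma mdom_BCT2: "mdom BCT2 = {A. \<forall>i. closed (A i) \<and> interior (A i) = {}}"
proof -
  have "- (\<Union>i. A i) \<noteq> {}" if "\<forall>i. closed (A i) \<and> interior (A i) = {}"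
    for A :: "nat \<Rightarrow> cantor set"
    using cantor_Baire[of A] that by blast
  then show ?thesis by (auto simp: mdom_def BCT2_def Compl_eq_Diff_UNIV)
qed

lemma run_Minimize_eq_Some_iff:
  "run (Minimize f) r x = Some n \<longleftrightarrow>
     run f r (prod_encode (x, n)) = Some 0 \<and>
     (\<forall>m<n. \<exists>v. run f r (prod_encode (x, m)) = Some (Suc v))"
proof -
  define P where "P n \<longleftrightarrow> run f r (prod_encode (x, n)) = Some 0 \<and>
    (\<forall>m<n. run f r (prod_encode (x, m)) \<noteq> None)" for n
  have "run (Minimize f) r x = (if \<exists>n. P n then Some (LEAST n. P n) else None)"
    unfolding P_def by (simp add: Let_def)
  moreover have "(LEAST n. P n) = n" if "P n" "\<forall>m<n. \<not> P m"
    using that by (intro Least_equality) (auto simp: not_less[symmetric])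
  moreover have "P n" if "\<exists>n. P n" "(LEAST n. P n) = n"
    using LeastI_ex[OF that(1)] that(2) by simp
  moreover have "\<forall>m<n. \<not> P m" if "(LEAST n. P n) = n"
    using not_less_Least[of _ P] that by blast
  ultimately have "run (Minimize f) r x = Some n \<longleftrightarrow> P n \<and> (\<forall>m<n. \<not> P m)"
    by (metis (no_types, lifting) option.distinct(1) option.inject)
  also have "\<dots> \<longleftrightarrow> run f r (prod_encode (x, n)) = Some 0 \<and>
     (\<forall>m<n. \<exists>v. run f r (prod_encode (x, m)) = Some (Suc v))"
  proof
    assume *: "P n \<and> (\<forall>m<n. \<not> P m)"
    have "\<exists>v. run f r (prod_encode (x, m)) = Some (Suc v)" if "m < n" for m
    proof -
      have defd: "run f r (prod_encode (x, k)) \<noteq> None" if "k < n" for k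
        using * that unfolding P_def by blast
      then have "\<forall>k<m. run f r (prod_encode (x, k)) \<noteq> None"
        using \<open>m < n\<close> less_trans by blast
      moreover have "\<not> P m" using * \<open>m < n\<close> by blast
      ultimately have "run f r (prod_encode (x, m)) \<noteq> Some 0" unfolding P_def by blast
      then show ?thesis
        using defd[OF \<open>m < n\<close>] not0_implies_Suc by (metis option.exhaust)
    qed
    with * show "run f r (prod_encode (x, n)) = Some 0 \<and>
        (\<forall>m<n. \<exists>v. run f r (prod_encode (x, m)) = Some (Suc v))"
      unfolding P_def by blast
  next
    assume *: "run f r (prod_encode (x, n)) = Some 0 \<and>
      (\<forall>m<n. \<exists>v. run f r (prod_encode (x, m)) = Some (Suc v))"
    then have "P n" unfolding P_def by fastforce
    moreover have "\<not> P m" if "m < n" for m using * that unfolding P_def by fastforce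
    ultimately show "P n \<and> (\<forall>m<n. \<not> P m)" by blast
  qed
  finally show ?thesis .
qed

lemma open_run: "open {r. run c r x = Some y}"
proof (induction c arbitrary: x y)
  case Query
  have "{r :: nat \<Rightarrow> nat. run Query r x = Some y} = (\<lambda>r. r x) -` {y}" by auto
  moreover have "open ((\<lambda>r :: nat \<Rightarrow> nat. r x) -` {y})"
    by (intro open_vimage open_discrete continuous_on_product_coordinates)
  ultimately show ?case by simp
next
  case (Pairing f g)
  have "{r. run (Pairing f g) r x = Some y} =
      {r. \<exists>a b. (run f r x = Some a \<and> run g r x = Some b) \<and> prod_encode (a, b) = y}"
    by (auto simp: bind_eq_Some_conv)
  then show ?case
    by (simp only:) (intro open_Collect_ex open_Collect_conj Pairing open_Collect_const)
next
  case (Comp f g)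
  have "{r. run (Comp f g) r x = Some y} =
      {r. \<exists>b. run g r x = Some b \<and> run f r b = Some y}"
    by (auto simp: bind_eq_Some_conv)
  then show ?case by (simp only:) (intro open_Collect_ex open_Collect_conj Comp)
next
  case (PrimRec f g)
  define R where "R = (\<lambda>r. rec_nat (run f r (fst (prod_decode x)))
       (\<lambda>k v. Option.bind v
          (\<lambda>b. run g r (prod_encode (fst (prod_decode x), prod_encode (k, b))))))"
  have "open {r. R r n = Some y}" for n y
  proof (induction n arbitrary: y)
    case 0
    show ?case by (simp add: R_def PrimRec)
  next
    case (Suc n)
    have "{r. R r (Suc n) = Some y} = {r. \<exists>b. R r n = Some b \<and>
        run g r (prod_encode (fst (prod_decode x), prod_encode (n, b))) = Some y}"
      by (auto simp: R_def bind_eq_Some_conv)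
    then show ?case by (simp only:) (intro open_Collect_ex open_Collect_conj PrimRec Suc)
  qed
  then show ?case by (simp add: R_def)
next
  case (Minimize f)
  have "{r. run (Minimize f) r x = Some y} = {r. run f r (prod_encode (x, y)) = Some 0} \<inter>
      (\<Inter>m<y. {r. \<exists>v. run f r (prod_encode (x, m)) = Some (Suc v)})"
    by (auto simp: run_Minimize_eq_Some_iff simp del: run.simps)
  moreover have "open \<dots>"
    by (intro open_Int open_INT open_Collect_ex Minimize finite_lessThan ballI)
  ultimately show ?case by simp
qed simp_all

lemma open_U_set: "open (U_set i q)"
proof -
  have "continuous_on UNIV (\<lambda>p. join (name_of p) (name_of q))"
  proof (intro continuous_on_coordinatewise_then_product)
    fix n
    have "continuous_on B (of_bool :: bool \<Rightarrow> nat)" for B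
      by (auto simp: continuous_on_open_invariant intro!: exI[of _ "of_bool -` _"] open_discrete)
    then have "continuous_on UNIV ((of_bool :: bool \<Rightarrow> nat) \<circ> (\<lambda>p :: cantor. p k))" for k
      by (intro continuous_on_compose continuous_on_product_coordinates)
    then show "continuous_on UNIV (\<lambda>p. join (name_of p) (name_of q) n)"
      by (cases "even n") (simp_all add: join_def name_of_def o_def)
  qed
  moreover have "open {r. \<exists>y. run (prog_of_nat i) r 0 = Some y}"
    by (intro open_Collect_ex open_run)
  moreover have "U_set i q =
      (\<lambda>p. join (name_of p) (name_of q)) -` {r. \<exists>y. run (prog_of_nat i) r 0 = Some y}"
    by (auto simp: U_set_def phi_def)
  ultimately show ?thesis using open_vimage by metis
qed

lemma mdom_one_GEN: "mdom one_GEN = UNIV"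
proof -
  have "\<exists>p. one_generic_in p q" for q
  proof -
    define B where "B i = - (U_set i q \<union> interior (- U_set i q))" for i
    have "closed (B i)" for i
      unfolding B_def by (intro closed_Compl open_Un open_U_set open_interior)
    moreover have "interior (B i) = {}" for i
    proof -
      have "B i \<subseteq> - U_set i q" "B i \<subseteq> - interior (- U_set i q)" unfolding B_def by blast+
      moreover from this have "interior (B i) \<subseteq> interior (- U_set i q)"
        by (intro interior_mono)
      ultimately show ?thesis using interior_subset[of "B i"] by blast
    qed
    ultimately have "\<Union>(range B) \<noteq> UNIV" by (rule cantor_Baire)
    then obtain p where p: "\<And>i. p \<notin> B i" by blast
    have "\<exists>w. p \<in> cylinder w \<and> (cylinder w \<subseteq> U_set i q \<or> cylinder w \<inter> U_set i q = {})" for i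
    proof (cases "p \<in> U_set i q")
      case True
      then show ?thesis by (metis cylinder_subset_open open_U_set)
    next
      case False
      then have "p \<in> interior (- U_set i q)" using p[of i] by (simp add: B_def)
      then obtain w where "p \<in> cylinder w" "cylinder w \<subseteq> interior (- U_set i q)"
        by (metis cylinder_subset_open open_interior)
      then show ?thesis using interior_subset[of "- U_set i q"] by blast
    qed
    then show ?thesis by (auto simp: one_generic_in_def)
  qed
  then show ?thesis by (auto simp: mdom_def one_GEN_def)
qed

end

theory Submission
  imports Defs
begin

text \<open>
  The idea is topological: the functionals \<open>K\<close> and \<open>H\<close> of a reduction determine each entry of a
  value from a finite part of the argument, and no finite part of a sequence reveals its limit.

  Consider instances with \<open>A\<^sub>0\<close> the closure of a sequence \<open>x\<^sub>0, x\<^sub>1, \<dots>\<close> of points and all other \<open>A\<^sub>i\<close>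
  empty.  If the sequence converges, then \<open>A\<^sub>0\<close> is the countable set of the \<open>x\<^sub>j\<close> and their limit, so
  the instance is in the domain of \<^const>\<open>BCT2\<close> and the limit is a wrong answer.  The plan is to let
  the sequence converge to the very answer that the reduction produces.  The reduction turns \<open>x\<close>
  into an oracle \<open>\<kappa> x\<close>, and then \<open>x\<close> together with any \<open>g\<close> that is 1-generic in \<open>\<kappa> x\<close> into an
  answer \<open>\<eta> x g\<close>; so \<open>x\<close> and one suitable \<open>g\<close> are built simultaneously, by forcing.

  A condition fixes the first \<open>m\<close> points of \<open>x\<close> and the first \<open>m\<close> bits of \<open>g\<close>, and it fixes the first
  \<open>n\<close> bits of all later points.  Two things are done to a condition at stage \<open>n\<close>.
  Genericity (lemma \<open>decide\<close>): if some extension puts \<open>g\<close> into the \<open>n\<close>-th open set computed from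
  \<open>\<kappa> x\<close>, then it does so by finite information, and such an extension is taken; otherwise the
  condition itself keeps \<open>g\<close> out of this set.
  Diagonalization (lemma \<open>copy\<close>): continuing \<open>x\<close> by a constant gives a legitimate instance, and
  the condition on \<open>g\<close> contains points that are 1-generic in the corresponding oracle, so the reduction
  must answer; its bit number \<open>n\<close> depends on finite information only.  Once this
  information is fixed, all later points of \<open>x\<close> are required to have that bit.
  In the limit \<open>g\<close> is 1-generic in \<open>\<kappa> x\<close>, and \<open>x\<close> converges to \<open>\<eta> x g\<close>.
\<close>

section \<open>Finite information\<close>

definition agree :: "nat \<Rightarrow> (nat \<Rightarrow> 'a) \<Rightarrow> (nat \<Rightarrow> 'a) \<Rightarrow> bool" where
  "agree N p q \<longleftrightarrow> (\<forall>k<N. p k = q k)"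

lemma agree_refl [simp]: "agree N p p"
  by (simp add: agree_def)

lemma agree_trans: "agree N p q \<Longrightarrow> agree N q r \<Longrightarrow> agree N p r"
  by (simp add: agree_def)

lemma agree_mono: "agree N p q \<Longrightarrow> M \<le> N \<Longrightarrow> agree M p q"
  by (simp add: agree_def)

lemma agree_join: "agree N p p' \<Longrightarrow> agree N q q' \<Longrightarrow> agree N (join p q) (join p' q')"
  by (auto simp: agree_def join_def)

lemma agree_name_of_iff: "agree N (name_of p) (name_of q) \<longleftrightarrow> agree N p q"
  by (auto simp: agree_def name_of_def)

lemma mem_cylinder_map_iff: "p \<in> cylinder (map g [0..<N]) \<longleftrightarrow> agree N g p"
  by (auto simp: cylinder_def agree_def)

lemma open_imp_agree:
  fixes V :: "(nat \<Rightarrow> 'a::topological_space) set"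
  assumes "open V" "p \<in> V"
  shows "\<exists>N. \<forall>q. agree N p q \<longrightarrow> q \<in> V"
proof -
  from assms have "openin (product_topology (\<lambda>_. euclidean) UNIV) V"
    by (simp add: euclidean_product_topology)
  then obtain X where "p \<in> Pi\<^sub>E UNIV X" "Pi\<^sub>E UNIV X \<subseteq> V"
      "finite {i. X i \<noteq> topspace (euclidean :: 'a topology)}"
    using product_topology_open_contains_basis[OF _ assms(2)] by blast
  then have X: "p \<in> Pi\<^sub>E UNIV X" "finite {i. X i \<noteq> UNIV}" "Pi\<^sub>E UNIV X \<subseteq> V"
    by (simp_all only: topspace_euclidean)
  then obtain N where "{i. X i \<noteq> UNIV} \<subseteq> {..<N}"
    using finite_nat_iff_bounded by blast
  then have N: "X i = UNIV" if "\<not> i < N" for i using that by blast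
  have "q \<in> V" if "agree N p q" for q
  proof -
    have "q i \<in> X i" for i
      using N[of i] PiE_mem[OF X(1), of i] that by (cases "i < N") (simp_all add: agree_def)
    then show ?thesis using X(3) by (auto simp: PiE_UNIV_domain)
  qed
  then show ?thesis by blast
qed

lemma open_cylinder: "open (cylinder w)"
proof -
  have "open {p :: cantor. p k = b}" for k b
  proof -
    have "open ((\<lambda>p :: cantor. p k) -` {b})"
      by (intro open_vimage open_discrete continuous_on_product_coordinates)
    then show ?thesis by (simp add: vimage_def)
  qed
  then have "open (\<Inter>k<length w. {p. p k = w ! k})" by (intro open_INT) auto
  moreover have "(\<Inter>k<length w. {p. p k = w ! k}) = cylinder w"
    by (auto simp: cylinder_def)
  ultimately show ?thesis by simp
qed

lemma mem_closure_iff_agree: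
  fixes y :: cantor
  shows "y \<in> closure S \<longleftrightarrow> (\<forall>N. \<exists>x\<in>S. agree N y x)"
proof
  assume y: "y \<in> closure S"
  show "\<forall>N. \<exists>x\<in>S. agree N y x"
  proof
    fix N
    have "y \<in> cylinder (map y [0..<N])" by (simp add: mem_cylinder_map_iff)
    then have "S \<inter> cylinder (map y [0..<N]) \<noteq> {}"
      using y open_cylinder closure_iff_nhds_not_empty[of y S] by blast
    then show "\<exists>x\<in>S. agree N y x" by (auto simp: mem_cylinder_map_iff)
  qed
next
  assume S: "\<forall>N. \<exists>x\<in>S. agree N y x"
  show "y \<in> closure S"
    unfolding closure_iff_nhds_not_empty
  proof (intro allI impI)
    fix A V assume "V \<subseteq> A" "open V" "y \<in> V"
    then show "S \<inter> A \<noteq> {}" using open_imp_agree[of V y] S by blast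
  qed
qed

lemma run_finite_use:
  assumes "run c r a = Some v"
  shows "\<exists>N. \<forall>r'. agree N r r' \<longrightarrow> run c r' a = Some v"
  using open_imp_agree[OF open_run[of c a v], of r] assms by simp

text \<open>
  Programs computing a partial functional are only known to be correct on its domain, so continuity
  is relative to the domain.
\<close>

lemma computable_finite_use:
  assumes "computable_baire F" "p \<in> dom F"
  shows "\<exists>N. \<forall>p'\<in>dom F. agree N p p' \<longrightarrow> agree M (the (F p)) (the (F p'))"
proof (induction M)
  case 0
  then show ?case by (simp add: agree_def)
next
  case (Suc M)
  then obtain N where N: "\<forall>p'\<in>dom F. agree N p p' \<longrightarrow> agree M (the (F p)) (the (F p'))"
    by blast
  obtain i where i: "\<And>p n. p \<in> dom F \<Longrightarrow> run (prog_of_nat i) p n = Some (the (F p) n)"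
    using assms(1) by (auto simp: computable_baire_def phi_def)
  obtain L where L: "\<forall>p'. agree L p p' \<longrightarrow> run (prog_of_nat i) p' M = Some (the (F p) M)"
    using run_finite_use[OF i[OF assms(2)]] by blast
  have "agree (Suc M) (the (F p)) (the (F p'))" if "p' \<in> dom F" "agree (max N L) p p'" for p'
  proof -
    have "the (F p') M = the (F p) M"
      using L i[OF that(1), of M] agree_mono[OF that(2)] by force
    moreover have "agree M (the (F p)) (the (F p'))"
      using N that agree_mono by (metis max.cobounded1)
    ultimately show ?thesis by (auto simp: agree_def less_Suc_eq)
  qed
  then show ?case by blast
qed

lemma U_set_finite_use:
  assumes "g \<in> U_set i q"
  shows "\<exists>N. \<forall>g' q'. agree N g g' \<longrightarrow> agree N q q' \<longrightarrow> g' \<in> U_set i q'"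
proof -
  obtain v where "run (prog_of_nat i) (join (name_of g) (name_of q)) 0 = Some v"
    using assms by (auto simp: U_set_def phi_def)
  from run_finite_use[OF this] obtain N where
    "\<And>r. agree N (join (name_of g) (name_of q)) r \<Longrightarrow> run (prog_of_nat i) r 0 = Some v"
    by blast
  then have "run (prog_of_nat i) (join (name_of g') (name_of q')) 0 = Some v"
    if "agree N g g'" "agree N q q'" for g' q'
    using that by (simp add: agree_join agree_name_of_iff)
  then show ?thesis by (auto simp: U_set_def phi_def)
qed


section \<open>Density of the generic points\<close>

text \<open>
  A cylinder is a copy of the whole space, and prefixing a fixed string carries nowhere dense
  closed sets back to nowhere dense closed sets.  So the Baire category theorem localizes.
\<close>

lemma cantor_Baire_cylinder:
  fixes A :: "nat \<Rightarrow> cantor set"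
  assumes "\<And>i. closed (A i)" "\<And>i. interior (A i) = {}"
  shows "\<exists>p\<in>cylinder w. \<forall>i. p \<notin> A i"
proof -
  define graft where "graft p k = (if k < length w then w ! k else p (k - length w))"
    for p :: cantor and k
  have cont: "continuous_on UNIV graft"
  proof (rule continuous_on_coordinatewise_then_product)
    fix k show "continuous_on UNIV (\<lambda>p. graft p k)"
      by (cases "k < length w") (simp_all add: graft_def continuous_on_product_coordinates)
  qed
  have "\<Union>(range (\<lambda>i. graft -` A i)) \<noteq> UNIV"
  proof (rule cantor_Baire)
    fix i
    show "closed (graft -` A i)" using closed_vimage[OF assms(1) cont] .
    show "interior (graft -` A i) = {}"
    proof (rule ccontr)
      assume "interior (graft -` A i) \<noteq> {}"
      then obtain p where "p \<in> interior (graft -` A i)" by blast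
      then obtain v where v: "p \<in> cylinder v" "cylinder v \<subseteq> interior (graft -` A i)"
        using cylinder_subset_open[OF open_interior] by metis
      have "cylinder (w @ v) \<subseteq> A i"
      proof
        fix z assume z: "z \<in> cylinder (w @ v)"
        have "z k = w ! k" if "k < length w" for k
          using z that by (auto simp: cylinder_def nth_append dest: spec[of _ k])
        then have "graft (\<lambda>k. z (k + length w)) = z"
          by (auto simp: graft_def fun_eq_iff)
        moreover have "(\<lambda>k. z (k + length w)) \<in> cylinder v"
          using z by (auto simp: cylinder_def nth_append dest: spec[of _ "_ + length w"])
        ultimately show "z \<in> A i" using v(2) interior_subset by fastforce
      qed
      then have "cylinder (w @ v) \<subseteq> interior (A i)" by (simp add: interior_maximal open_cylinder)
      moreover have "(\<lambda>k. if k < length (w @ v) then (w @ v) ! k else False) \<in> cylinder (w @ v)"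
        by (simp add: cylinder_def)
      ultimately show False using assms(2) by blast
    qed
  qed
  then obtain p where "\<And>i. graft p \<notin> A i" by blast
  moreover have "graft p \<in> cylinder w" by (simp add: graft_def cylinder_def)
  ultimately show ?thesis by blast
qed

text \<open>
  A point fails to be 1-generic only if it lies on the boundary of one of the countably many open
  sets, and these boundaries are closed and nowhere dense.
\<close>

lemma one_generic_dense: "\<exists>p. agree m w p \<and> one_generic_in p q"
proof -
  define B where "B i = - U_set i q - interior (- U_set i q)" for i
  have cl: "closed (B i)" for i
    unfolding B_def by (intro closed_Diff closed_Compl open_U_set open_interior)
  have "interior (B i) = {}" for i
  proof -
    have "interior (B i) \<subseteq> interior (- U_set i q)" by (intro interior_mono) (auto simp: B_def)
    then show ?thesis using interior_subset[of "B i"] by (auto simp: B_def)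
  qed
  with cl obtain p where p: "p \<in> cylinder (map w [0..<m])" "\<And>i. p \<notin> B i"
    using cantor_Baire_cylinder[of B] by blast
  have "\<exists>w. p \<in> cylinder w \<and> (cylinder w \<subseteq> U_set i q \<or> cylinder w \<inter> U_set i q = {})" for i
  proof (cases "p \<in> U_set i q")
    case True
    then show ?thesis by (metis cylinder_subset_open open_U_set)
  next
    case False
    then have "p \<in> interior (- U_set i q)" using p(2)[of i] by (simp add: B_def)
    then obtain w where "p \<in> cylinder w" "cylinder w \<subseteq> interior (- U_set i q)"
      by (metis cylinder_subset_open open_interior)
    then show ?thesis using interior_subset[of "- U_set i q"] by blast
  qed
  with p(1) show ?thesis by (auto simp: one_generic_in_def mem_cylinder_map_iff)
qed


section \<open>Instances given by a sequence of points\<close>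

definition nowhere_dense_range :: "(nat \<Rightarrow> cantor) \<Rightarrow> bool" where
  "nowhere_dense_range x \<longleftrightarrow> interior (closure (range x)) = {}"

text \<open>
  The closure of the range adds only the limit, so it is countable, while no cylinder is: the
  proof diagonalizes inside the cylinder against the limit and all the points.
\<close>

lemma convergent_nowhere_dense_range:
  assumes "\<And>n. \<exists>m. \<forall>j\<ge>m. agree n y (x j)"
  shows "nowhere_dense_range x"
proof (rule ccontr)
  assume "\<not> nowhere_dense_range x"
  then obtain p where "p \<in> interior (closure (range x))"
    by (auto simp: nowhere_dense_range_def)
  then obtain w where "cylinder w \<subseteq> interior (closure (range x))"
    using cylinder_subset_open[OF open_interior] by metis
  then have w: "cylinder w \<subseteq> closure (range x)" using interior_subset by blast
  define z where "z = case_nat y x"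
  define d where "d k = (if k < length w then w ! k else \<not> z (k - length w) k)" for k
  have "d \<noteq> z j" for j
  proof
    assume "d = z j"
    then have "d (j + length w) = z j (j + length w)" by simp
    then show False by (simp add: d_def)
  qed
  from this[of 0] this[of "Suc _"] have d: "d \<noteq> y" "d \<noteq> x j" for j
    by (simp_all add: z_def)
  then obtain i where i: "d i \<noteq> y i" by blast
  obtain m where m: "\<forall>j\<ge>m. agree (Suc i) y (x j)" using assms by blast
  have "\<forall>j. \<exists>k. d k \<noteq> x j k" using d(2) by (simp add: fun_eq_iff)
  then obtain k where k: "\<And>j. d (k j) \<noteq> x j (k j)" by metis
  \<comment> \<open>A prefix of this length separates \<open>d\<close> from the limit at \<open>i\<close>, and thereby from all \<open>x j\<close> with
    \<open>j \<ge> m\<close>; it also separates \<open>d\<close> from the finitely many remaining \<open>x j\<close> at \<open>k j\<close>.\<close>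
  define N where "N = Suc (i + (\<Sum>j<m. k j))"
  have "d \<in> closure (range x)" using w by (auto simp: d_def cylinder_def)
  then obtain j where j: "agree N d (x j)" by (auto simp: mem_closure_iff_agree)
  show False
  proof (cases "j < m")
    case True
    then have "k j \<le> (\<Sum>j<m. k j)" by (intro member_le_sum) auto
    then show False using j k[of j] by (auto simp: agree_def N_def)
  next
    case False
    then have "y i = x j i" using m by (metis agree_def lessI not_less)
    moreover have "d i = x j i" using j by (simp add: agree_def N_def)
    ultimately show False using i by simp
  qed
qed

text \<open>
  The columns of column \<open>0\<close> are names of the points \<open>x j\<close>, tagged by a leading \<open>0\<close>; the constant \<open>1\<close>
  elsewhere names the sequence that is constantly \<^const>\<open>Infinity\<close>, that is, the empty set.
\<close>

definition instance_name :: "(nat \<Rightarrow> cantor) \<Rightarrow> nat \<Rightarrow> nat" where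
  "instance_name x n =
     (case prod_decode n of (i, l) \<Rightarrow> case prod_decode l of (j, k) \<Rightarrow>
        if i = 0 then case_nat 0 (name_of (x j)) k else 1)"

definition instance_sets :: "(nat \<Rightarrow> cantor) \<Rightarrow> nat \<Rightarrow> cantor set" where
  "instance_sets x i = (if i = 0 then closure (range x) else {})"

lemma repr_instance_name:
  "repr_seq repr_closed_pos (instance_name x) = Some (instance_sets x)"
proof -
  have "repr_closed_pos (column (instance_name x) i) = Some (instance_sets x i)" for i
  proof -
    define z where "z j = (if i = 0 then Point (x j) else Infinity)" for j
    have "repr_cantor_inf (column (column (instance_name x) i) j) = Some (z j)" for j
    proof (cases "i = 0")
      case True
      then have "column (column (instance_name x) i) j = case_nat 0 (name_of (x j))"
        by (simp add: column_def instance_name_def fun_eq_iff)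
      then show ?thesis using True
        by (simp add: repr_cantor_inf_def repr_cantor_eq_Some_iff z_def)
    next
      case False
      then have "column (column (instance_name x) i) j = (\<lambda>_. 1)"
        by (simp add: column_def instance_name_def fun_eq_iff)
      then show ?thesis using False by (simp add: repr_cantor_inf_def z_def)
    qed
    then have "repr_seq repr_cantor_inf (column (instance_name x) i) = Some z"
      by (auto simp: repr_seq_def)
    moreover have "Point -` range z = (if i = 0 then range x else {})"
      by (auto simp: z_def)
    then have "Point -` closure (range z) = instance_sets x i"
      by (simp add: Point_vimage_closure instance_sets_def)
    ultimately show ?thesis by (simp add: repr_closed_pos_def)
  qed
  then show ?thesis by (auto simp: repr_seq_def)
qed

text \<open>
  Since Cantor pairing dominates its components, the first \<open>N\<close> entries of the name mention only
  points with index below \<open>N\<close>.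
\<close>

lemma agree_instance_name:
  assumes "agree N x x'"
  shows "agree N (instance_name x) (instance_name x')"
  unfolding agree_def
proof (intro allI impI)
  fix n assume "n < N"
  obtain i l where il: "prod_decode n = (i, l)" by fastforce
  obtain j k where jk: "prod_decode l = (j, k)" by fastforce
  have "n = prod_encode (i, prod_encode (j, k))" using il jk by (metis prod_decode_inverse)
  then have "j \<le> n" using le_prod_encode_1 le_prod_encode_2 order_trans by metis
  then have "x j = x' j" using assms \<open>n < N\<close> by (simp add: agree_def)
  then show "instance_name x n = instance_name x' n" by (simp add: instance_name_def il jk split: nat.split)
qed

lemma BCT2_instance_sets:
  assumes "nowhere_dense_range x"
  shows "BCT2 (instance_sets x) = - closure (range x)"
  using assms by (auto simp: BCT2_def instance_sets_def nowhere_dense_range_def)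


section \<open>A sequence converging to the alleged solution\<close>

text \<open>
  What remains of a reduction once names and programs are stripped off.  The
  assumptions are contradictory; the locale carries the construction that shows this.
\<close>

locale continuous_avoidance =
  fixes \<kappa> :: "(nat \<Rightarrow> cantor) \<Rightarrow> cantor" and \<eta> :: "(nat \<Rightarrow> cantor) \<Rightarrow> cantor \<Rightarrow> cantor"
  assumes oracle_use: "nowhere_dense_range x \<Longrightarrow>
      \<exists>N. \<forall>x'. nowhere_dense_range x' \<longrightarrow> agree N x x' \<longrightarrow> agree M (\<kappa> x) (\<kappa> x')"
    and solution_use: "nowhere_dense_range x \<Longrightarrow> one_generic_in g (\<kappa> x) \<Longrightarrow>
      \<exists>N. \<forall>x' g'. nowhere_dense_range x' \<longrightarrow> one_generic_in g' (\<kappa> x') \<longrightarrow>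
        agree N x x' \<longrightarrow> agree N g g' \<longrightarrow> agree M (\<eta> x g) (\<eta> x' g')"
    and avoids: "nowhere_dense_range x \<Longrightarrow> one_generic_in g (\<kappa> x) \<Longrightarrow>
      \<eta> x g \<notin> closure (range x)"
begin

text \<open>
  The pairs compatible with a condition of level \<open>n\<close>.  The point \<open>x m\<close> serves as the carrier of the
  \<open>n\<close> bits to which all points from index \<open>m\<close> on are committed.
\<close>

definition box :: "nat \<Rightarrow> (nat \<Rightarrow> cantor) \<Rightarrow> nat \<Rightarrow> cantor \<Rightarrow> ((nat \<Rightarrow> cantor) \<times> cantor) set" where
  "box n x m g = {(x', g'). agree m x x' \<and> agree m g g' \<and> (\<forall>j\<ge>m. agree n (x m) (x' j))}"

lemma box_mono:
  assumes "(x', g') \<in> box n x m g" "m \<le> m'" "n \<le> n'"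
  shows "box n' x' m' g' \<subseteq> box n x m g"
proof (intro subsetI; clarify)
  fix x'' g'' assume "(x'', g'') \<in> box n' x' m' g'"
  then have *: "agree m' x' x''" "agree m' g' g''" "\<And>j. j \<ge> m' \<Longrightarrow> agree n' (x' m') (x'' j)"
    by (auto simp: box_def)
  have a: "agree m x x'" "agree m g g'" "\<And>j. j \<ge> m \<Longrightarrow> agree n (x m) (x' j)"
    using assms(1) by (auto simp: box_def)
  have "agree n (x m) (x'' j)" if "j \<ge> m" for j
  proof (cases "j < m'")
    case True
    then have "x'' j = x' j" using *(1) by (simp add: agree_def)
    then show ?thesis using a(3)[OF that] by simp
  next
    case False
    then have "agree n (x' m') (x'' j)" using *(3) assms(3) by (meson agree_mono not_less)
    then show ?thesis using a(3)[OF assms(2)] agree_trans by blast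
  qed
  then show "(x'', g'') \<in> box n x m g"
    using * a assms(2) by (auto simp: box_def intro: agree_trans agree_mono)
qed

text \<open>
  The second component ranges over all points compatible with the condition, not only over generic
  ones: this is what makes the condition a witness for 1-genericity.
\<close>

definition decides :: "nat \<Rightarrow> nat \<Rightarrow> (nat \<Rightarrow> cantor) \<Rightarrow> nat \<Rightarrow> cantor \<Rightarrow> bool" where
  "decides i n x m g \<longleftrightarrow>
     (\<forall>(x', g') \<in> box n x m g. nowhere_dense_range x' \<longrightarrow> g' \<in> U_set i (\<kappa> x')) \<or>
     (\<forall>(x', g') \<in> box n x m g. nowhere_dense_range x' \<longrightarrow> g' \<notin> U_set i (\<kappa> x'))"

lemma decides_antimono:
  assumes "decides i n x m g" "box n' x' m' g' \<subseteq> box n x m g"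
  shows "decides i n' x' m' g'"
  using assms unfolding decides_def by blast

text \<open>
  Being in the open set is witnessed by finitely many bits of \<open>g'\<close> and of the oracle, and those bits of
  the oracle by finitely many points of \<open>x'\<close>.  If no pair in the box has such a witness, the
  condition decides negatively as it stands.
\<close>

lemma decide:
  assumes "(x, g) \<in> box n x m g"
  shows "\<exists>x' m' g'. (x', g') \<in> box n x m g \<and> m \<le> m' \<and> decides i n x' m' g'"
proof (cases "\<exists>(x', g') \<in> box n x m g. nowhere_dense_range x' \<and> g' \<in> U_set i (\<kappa> x')")
  case False
  then have "decides i n x m g" by (auto simp: decides_def)
  with assms show ?thesis by blast
next
  case True
  then obtain x' g' where x': "(x', g') \<in> box n x m g" "nowhere_dense_range x'"
      and "g' \<in> U_set i (\<kappa> x')" by blast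
  then obtain M where M: "\<And>g'' q. agree M g' g'' \<Longrightarrow> agree M (\<kappa> x') q \<Longrightarrow> g'' \<in> U_set i q"
    using U_set_finite_use by blast
  obtain N where N: "\<And>x''. nowhere_dense_range x'' \<Longrightarrow> agree N x' x'' \<Longrightarrow> agree M (\<kappa> x') (\<kappa> x'')"
    using oracle_use[OF x'(2)] by blast
  define m' where "m' = max m (max M N)"
  have "g'' \<in> U_set i (\<kappa> x'')" if "(x'', g'') \<in> box n x' m' g'" "nowhere_dense_range x''" for x'' g''
  proof (rule M)
    show "agree M g' g''" using that(1) agree_mono[of m' g' g'' M] by (auto simp: box_def m'_def)
    have "agree N x' x''" using that(1) agree_mono[of m' x' x'' N] by (auto simp: box_def m'_def)
    then show "agree M (\<kappa> x') (\<kappa> x'')" using N that(2) by blast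
  qed
  then have "decides i n x' m' g'" by (auto simp: decides_def)
  moreover have "m \<le> m'" by (simp add: m'_def)
  ultimately show ?thesis using x'(1) by blast
qed

definition copies :: "nat \<Rightarrow> nat \<Rightarrow> (nat \<Rightarrow> cantor) \<Rightarrow> nat \<Rightarrow> cantor \<Rightarrow> bool" where
  "copies i n x m g \<longleftrightarrow>
     (\<forall>(x', g') \<in> box n x m g. nowhere_dense_range x' \<longrightarrow> one_generic_in g' (\<kappa> x') \<longrightarrow>
        \<eta> x' g' i = x m i)"

text \<open>
  The reduction cannot withhold its next bit: the condition contains an instance with constant
  tail and a generic for it, for which an answer has to be given.  The points already fixed do
  not prevent the later ones from taking over the bit, because bit \<open>n\<close> of the tail is still free.
\<close>

lemma copy:
  shows "\<exists>x' m' g'. (x', g') \<in> box n x m g \<and> m < m' \<and>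
    (x', g') \<in> box (Suc n) x' m' g' \<and> copies n (Suc n) x' m' g'"
proof -
  define z where "z j = (if j < m then x j else x m)" for j
  have "\<forall>j\<ge>m. agree k (x m) (z j)" for k by (simp add: z_def)
  then have z: "nowhere_dense_range z" by (intro convergent_nowhere_dense_range) blast
  obtain g' where g': "agree m g g'" "one_generic_in g' (\<kappa> z)"
    using one_generic_dense by blast
  obtain N where N: "\<And>x' g''. nowhere_dense_range x' \<Longrightarrow> one_generic_in g'' (\<kappa> x') \<Longrightarrow>
        agree N z x' \<Longrightarrow> agree N g' g'' \<Longrightarrow> agree (Suc n) (\<eta> z g') (\<eta> x' g'')"
    using solution_use[OF z g'(2)] by blast
  define m' where "m' = max (Suc m) N"
  have m': "m < m'" "N \<le> m'" by (auto simp: m'_def)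
  \<comment> \<open>Changing the tail beyond the use \<open>N\<close> at bit \<open>n\<close> stays in the box, which binds only bits below \<open>n\<close>.\<close>
  define x' where "x' j = (if j < m' then z j else (x m)(n := \<eta> z g' n))" for j
  have "(x', g') \<in> box n x m g"
    using g'(1) m' by (auto simp: box_def x'_def z_def agree_def)
  moreover have "(x', g') \<in> box (Suc n) x' m' g'"
    by (auto simp: box_def x'_def)
  moreover have "\<eta> x'' g'' n = x' m' n" if "(x'', g'') \<in> box (Suc n) x' m' g'"
    "nowhere_dense_range x''" "one_generic_in g'' (\<kappa> x'')" for x'' g''
  proof -
    have "agree m' z x'" by (simp add: agree_def x'_def)
    then have "agree N z x''" "agree N g' g''"
      using that(1) m'(2) agree_trans agree_mono by (fastforce simp: box_def)+
    then have "agree (Suc n) (\<eta> z g') (\<eta> x'' g'')" using N that by blast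
    then show ?thesis by (simp add: agree_def x'_def)
  qed
  then have "copies n (Suc n) x' m' g'" by (auto simp: copies_def)
  ultimately show ?thesis using m' by blast
qed

lemma step:
  assumes "(x, g) \<in> box n x m g"
  shows "\<exists>x' m' g'. (x', g') \<in> box n x m g \<and> m < m' \<and> (x', g') \<in> box (Suc n) x' m' g' \<and>
    decides n (Suc n) x' m' g' \<and> copies n (Suc n) x' m' g'"
proof -
  obtain x1 m1 g1 where 1: "(x1, g1) \<in> box n x m g" "m \<le> m1" "decides n n x1 m1 g1"
    using decide[OF assms] by blast
  obtain x2 m2 g2 where 2: "(x2, g2) \<in> box n x1 m1 g1" "m1 < m2"
      "(x2, g2) \<in> box (Suc n) x2 m2 g2" "copies n (Suc n) x2 m2 g2"
    using copy by blast
  have "box (Suc n) x2 m2 g2 \<subseteq> box n x1 m1 g1" using 2 by (intro box_mono) auto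
  then have "decides n (Suc n) x2 m2 g2" using 1(3) decides_antimono by blast
  moreover have "(x2, g2) \<in> box n x m g" using 2(1) box_mono[OF 1(1,2) order_refl] by blast
  ultimately show ?thesis using 1(2) 2 by (intro exI[of _ x2] exI[of _ m2] exI[of _ g2]) auto
qed

text \<open>
  The limit of a sequence of conditions made by \<open>step\<close> lies in all their boxes, so every
  decision and every copied bit applies to it.
\<close>

lemma contradiction: False
proof -
  define P where "P n c \<longleftrightarrow> (case c of (x, m, g) \<Rightarrow> (x, g) \<in> box n x m g)"
    for n and c :: "(nat \<Rightarrow> cantor) \<times> nat \<times> cantor"
  define Q where "Q n c c' \<longleftrightarrow> (case c of (x, m, g) \<Rightarrow> case c' of (x', m', g') \<Rightarrow>
      (x', g') \<in> box n x m g \<and> m < m' \<and>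
      decides n (Suc n) x' m' g' \<and> copies n (Suc n) x' m' g')" for n c c'
  have "\<exists>c. P 0 c" by (auto simp: P_def box_def agree_def)
  moreover have "\<exists>c'. P (Suc n) c' \<and> Q n c c'" if "P n c" for n c
  proof -
    obtain x m g where c: "c = (x, m, g)" using prod_cases3 by blast
    show ?thesis using step[of x g n m] that by (auto simp: P_def Q_def c)
  qed
  ultimately obtain c where c: "\<And>n. P n (c n)" "\<And>n. Q n (c n) (c (Suc n))"
    using dependent_nat_choice[of P Q] by metis
  define X M \<gamma> where "X n = fst (c n)" and "M n = fst (snd (c n))" and "\<gamma> n = snd (snd (c n))"
    for n
  have self: "(X n, \<gamma> n) \<in> box n (X n) (M n) (\<gamma> n)" for n
    using c(1)[of n] by (simp add: P_def X_def M_def \<gamma>_def case_prod_beta)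
  have next_box: "(X (Suc n), \<gamma> (Suc n)) \<in> box n (X n) (M n) (\<gamma> n)" and M_less: "M n < M (Suc n)"
    and dec: "decides n (Suc n) (X (Suc n)) (M (Suc n)) (\<gamma> (Suc n))"
    and cop: "copies n (Suc n) (X (Suc n)) (M (Suc n)) (\<gamma> (Suc n))" for n
    using c(2)[of n] by (simp_all add: Q_def X_def M_def \<gamma>_def case_prod_beta)
  have "strict_mono M" using M_less by (simp add: strict_mono_Suc_iff)
  then have M_ge: "n \<le> M n" for n by (rule strict_mono_imp_increasing)
  have "box (Suc n) (X (Suc n)) (M (Suc n)) (\<gamma> (Suc n)) \<subseteq> box n (X n) (M n) (\<gamma> n)" for n
    using next_box[of n] M_less[of n] by (intro box_mono) auto
  then have nested: "box k (X k) (M k) (\<gamma> k) \<subseteq> box n (X n) (M n) (\<gamma> n)" if "n \<le> k" for n k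
    using lift_Suc_antimono_le[of "\<lambda>n. box n (X n) (M n) (\<gamma> n)"] that by blast
  \<comment> \<open>Stage \<open>Suc j\<close> is late enough for entry \<open>j\<close> to be final, as \<open>j < M (Suc j)\<close>.\<close>
  define x where "x j = X (Suc j) j" for j
  define g where "g j = \<gamma> (Suc j) j" for j
  have later: "agree (M n) (X n) (X k)" "agree (M n) (\<gamma> n) (\<gamma> k)"
      "\<And>j. j \<ge> M n \<Longrightarrow> agree n (X n (M n)) (X k j)" if "n \<le> k" for n k
    using subsetD[OF nested[OF that] self[of k]] by (auto simp: box_def)
  have limit: "(x, g) \<in> box n (X n) (M n) (\<gamma> n)" for n
  proof -
    have eq: "X n j = x j \<and> \<gamma> n j = g j" if "j < M n" for j
    proof (cases "n \<le> Suc j")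
      case True
      then show ?thesis using later(1,2)[OF True] that by (auto simp: agree_def x_def g_def)
    next
      case False
      then have "Suc j \<le> n" by simp
      moreover have "j < M (Suc j)" using M_ge[of "Suc j"] by simp
      ultimately show ?thesis
        using later(1,2)[of "Suc j" n] by (auto simp: agree_def x_def g_def)
    qed
    have "agree n (X n (M n)) (x j)" if "j \<ge> M n" for j
    proof -
      have "n \<le> Suc j" using M_ge[of n] that by simp
      then show ?thesis using later(3) that by (auto simp: x_def)
    qed
    with eq show ?thesis by (auto simp: box_def agree_def)
  qed
  define y where "y n = X (Suc n) (M (Suc n)) n" for n
  have "agree n y (x j)" if "j \<ge> M n" for n j
    unfolding agree_def
  proof (intro allI impI)
    fix k assume "k < n"
    then have "M (Suc k) \<le> j"
      using that \<open>strict_mono M\<close> by (metis Suc_leI order_trans strict_mono_less_eq)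
    then have "agree (Suc k) (X (Suc k) (M (Suc k))) (x j)"
      using limit[of "Suc k"] by (auto simp: box_def)
    then show "y k = x j k" by (simp add: agree_def y_def)
  qed
  then have conv: "\<exists>m. \<forall>j\<ge>m. agree n y (x j)" for n by blast
  then have nd: "nowhere_dense_range x" by (rule convergent_nowhere_dense_range)
  have gen: "one_generic_in g (\<kappa> x)"
    unfolding one_generic_in_def
  proof
    fix i
    let ?w = "map g [0..<M (Suc i)]"
    have "(x, p) \<in> box (Suc i) (X (Suc i)) (M (Suc i)) (\<gamma> (Suc i))" if "p \<in> cylinder ?w" for p
      using limit[of "Suc i"] that agree_trans by (auto simp: box_def mem_cylinder_map_iff)
    then have "cylinder ?w \<subseteq> U_set i (\<kappa> x) \<or> cylinder ?w \<inter> U_set i (\<kappa> x) = {}"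
      using dec[of i] nd unfolding decides_def by blast
    moreover have "g \<in> cylinder ?w" by (simp add: mem_cylinder_map_iff)
    ultimately show "\<exists>w. g \<in> cylinder w \<and>
        (cylinder w \<subseteq> U_set i (\<kappa> x) \<or> cylinder w \<inter> U_set i (\<kappa> x) = {})" by blast
  qed
  have "\<eta> x g n = y n" for n
    using cop[of n] limit[of "Suc n"] nd gen by (auto simp: copies_def y_def)
  then have "\<eta> x g = y" by blast
  moreover have "y \<in> closure (range x)"
    using conv by (auto simp: mem_closure_iff_agree)
  ultimately show False using avoids[OF nd gen] by simp
qed

end


section \<open>From a Weihrauch reduction to the continuous situation\<close>

text \<open>
  Realizers of \<^const>\<open>one_GEN\<close> may choose any generic for each oracle, and may be undefined on
  everything that is not a name; the reduction has to cope with all of them.  Hence \<open>K p\<close> is a name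
  of some \<open>q\<close>, and every point that is 1-generic in \<open>q\<close> leads to an answer.
\<close>

lemma reduction_to_one_GEN:
  assumes red: "\<And>G. realizes repr_cantor repr_cantor G one_GEN \<Longrightarrow>
      realizes \<delta>X repr_cantor
        (\<lambda>p. Option.bind (K p) (\<lambda>k. Option.bind (G k) (\<lambda>r. H (join p r)))) f"
    and p: "\<delta>X p = Some a" "a \<in> mdom f"
  shows "\<exists>q. K p = Some (name_of q) \<and>
    (\<forall>g. one_generic_in g q \<longrightarrow> (\<exists>y. H (join p (name_of g)) = Some (name_of y) \<and> y \<in> f a))"
proof -
  \<comment> \<open>The realizer that answers according to the choice function \<open>\<gamma>\<close>; it is undefined on non-names.\<close>
  define G where "G \<gamma> r = map_option (\<lambda>q. name_of (\<gamma> q)) (repr_cantor r)" for \<gamma> r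
  have ans: "\<exists>q y. K p = Some (name_of q) \<and> H (join p (name_of (\<gamma> q))) = Some (name_of y) \<and> y \<in> f a"
    if "\<And>q. one_generic_in (\<gamma> q) q" for \<gamma>
  proof -
    have "realizes repr_cantor repr_cantor (G \<gamma>) one_GEN"
      using that unfolding realizes_def G_def
      by (auto simp: repr_cantor_eq_Some_iff one_GEN_def)
    from red[OF this] p obtain r y where
      "Option.bind (K p) (\<lambda>k. Option.bind (G \<gamma> k) (\<lambda>r. H (join p r))) = Some r"
      "repr_cantor r = Some y" "y \<in> f a"
      unfolding realizes_def by blast
    then show ?thesis
      by (auto simp: bind_eq_Some_conv G_def repr_cantor_eq_Some_iff)
  qed
  obtain \<gamma> where \<gamma>: "\<And>q. one_generic_in (\<gamma> q) q" using one_generic_dense by metis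
  obtain q where q: "K p = Some (name_of q)" using ans[OF \<gamma>] by blast
  have "\<exists>y. H (join p (name_of g)) = Some (name_of y) \<and> y \<in> f a" if "one_generic_in g q" for g
  proof -
    have "one_generic_in ((\<gamma>(q := g)) q') q'" for q' using \<gamma> that by simp
    from ans[OF this] obtain q' y where "K p = Some (name_of q')"
        "H (join p (name_of ((\<gamma>(q := g)) q'))) = Some (name_of y)" "y \<in> f a" by blast
    moreover have "q' = q"
      using calculation(1) q repr_cantor_eq_Some_iff by (metis option.inject)
    ultimately show ?thesis by auto
  qed
  with q show ?thesis by blast
qed

theorem corollary10p8:
  shows "\<not> weihrauch_le (repr_seq repr_closed_pos) repr_cantor BCT2
           repr_cantor repr_cantor one_GEN"
proof
  assume "weihrauch_le (repr_seq repr_closed_pos) repr_cantor BCT2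
           repr_cantor repr_cantor one_GEN"
  then obtain K H where K: "computable_baire K" and H: "computable_baire H"
    and red: "\<And>G. realizes repr_cantor repr_cantor G one_GEN \<Longrightarrow>
      realizes (repr_seq repr_closed_pos) repr_cantor
        (\<lambda>p. Option.bind (K p) (\<lambda>k. Option.bind (G k) (\<lambda>r. H (join p r)))) BCT2"
    unfolding weihrauch_le_def by blast
  have "\<exists>q. K (instance_name x) = Some (name_of q) \<and>
      (\<forall>g. one_generic_in g q \<longrightarrow> (\<exists>y. H (join (instance_name x) (name_of g)) = Some (name_of y) \<and>
        y \<notin> closure (range x)))" if x: "nowhere_dense_range x" for x
  proof -
    have "instance_sets x \<in> mdom BCT2"
      using x by (auto simp: mdom_BCT2 instance_sets_def nowhere_dense_range_def)
    then have "\<exists>q. K (instance_name x) = Some (name_of q) \<and>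
      (\<forall>g. one_generic_in g q \<longrightarrow> (\<exists>y. H (join (instance_name x) (name_of g)) = Some (name_of y) \<and>
        y \<in> BCT2 (instance_sets x)))"
      by (intro reduction_to_one_GEN[where \<delta>X = "repr_seq repr_closed_pos" and K = K and H = H]
          red repr_instance_name)
    then show ?thesis by (simp add: BCT2_instance_sets[OF x])
  qed
  then obtain \<kappa> where \<kappa>: "\<And>x. nowhere_dense_range x \<Longrightarrow>
        K (instance_name x) = Some (name_of (\<kappa> x))"
      "\<And>x g. nowhere_dense_range x \<Longrightarrow> one_generic_in g (\<kappa> x) \<Longrightarrow>
        \<exists>y. H (join (instance_name x) (name_of g)) = Some (name_of y) \<and> y \<notin> closure (range x)"
    by metis
  then obtain \<eta> where \<eta>: "\<And>x g. nowhere_dense_range x \<Longrightarrow> one_generic_in g (\<kappa> x) \<Longrightarrow>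
        H (join (instance_name x) (name_of g)) = Some (name_of (\<eta> x g))"
      "\<And>x g. nowhere_dense_range x \<Longrightarrow> one_generic_in g (\<kappa> x) \<Longrightarrow> \<eta> x g \<notin> closure (range x)"
    by metis
  have "continuous_avoidance \<kappa> \<eta>"
  proof
    fix x M assume x: "nowhere_dense_range x"
    then have "instance_name x \<in> dom K" using \<kappa>(1) by blast
    from computable_finite_use[OF K this, of M] obtain N where
      N: "\<And>p. p \<in> dom K \<Longrightarrow> agree N (instance_name x) p \<Longrightarrow>
        agree M (the (K (instance_name x))) (the (K p))" by blast
    have "agree M (\<kappa> x) (\<kappa> x')" if "nowhere_dense_range x'" "agree N x x'" for x'
      using N[of "instance_name x'"] \<kappa>(1)[OF x] \<kappa>(1)[OF that(1)] agree_instance_name[OF that(2)]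
      by (simp add: agree_name_of_iff domI)
    then show "\<exists>N. \<forall>x'. nowhere_dense_range x' \<longrightarrow> agree N x x' \<longrightarrow> agree M (\<kappa> x) (\<kappa> x')"
      by blast
  next
    fix x g M assume x: "nowhere_dense_range x" "one_generic_in g (\<kappa> x)"
    let ?p = "\<lambda>x g. join (instance_name x) (name_of g)"
    have "?p x g \<in> dom H" using \<eta>(1)[OF x] by blast
    from computable_finite_use[OF H this, of M] obtain N where
      N: "\<And>p. p \<in> dom H \<Longrightarrow> agree N (?p x g) p \<Longrightarrow>
        agree M (the (H (?p x g))) (the (H p))" by blast
    have "agree M (\<eta> x g) (\<eta> x' g')" if x': "nowhere_dense_range x'" "one_generic_in g' (\<kappa> x')"
      and a: "agree N x x'" "agree N g g'" for x' g'
      using N[of "?p x' g'"] \<eta>(1)[OF x] \<eta>(1)[OF x']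
        agree_join[OF agree_instance_name[OF a(1)] a(2)[folded agree_name_of_iff]]
      by (simp add: agree_name_of_iff domI)
    then show "\<exists>N. \<forall>x' g'. nowhere_dense_range x' \<longrightarrow> one_generic_in g' (\<kappa> x') \<longrightarrow>
        agree N x x' \<longrightarrow> agree N g g' \<longrightarrow> agree M (\<eta> x g) (\<eta> x' g')"
      by blast
  qed (use \<eta>(2) in blast)
  then show False by (rule continuous_avoidance.contradiction)
qed

end
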